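(* Let $W=\{1,\dots,n\}$ be a finite non-empty set of voters and let $\mathfrak{G}\subseteq\mathcal{P}(W)$ be a set of winning coalitions such that $W\in\mathfrak{G}$, $\emptyset\notin\mathfrak{G}$, and $\mathfrak{G}$ is monotone (if $A\in\mathfrak{G}$ and $A\subseteq B\subseteq W$ then $B\in\mathfrak{G}$). Let $\mathfrak{M}(\mathfrak{G})=\{V_1,\dots,V_m\}$ be the set of minimal winning coalitions, with $m=\#\mathfrak{M}(\mathfrak{G})$. For a voter $w\in W$ define the Shapley-Shubik index $$SSI_w:=\sum_{S}\frac{(n-\#S)!\,(\#S-1)!}{n!},$$ the sum ranging over all $S\in\mathfrak{G}$ with $w\in S$ and $S\setminus\{w\}\notin\mathfrak{G}$. Then for each voter $w$, $$SSI_w=\sum_{r=1}^m(-1)^{r-1}\sum_{1\leq i_1<\dots<i_r\leq m} s_{i_1,\dots,i_r}(w),$$ where $$s_{i_1,\dots,i_r}(w):=\begin{cases}\dfrac{1}{\#\bigcup_{j=1}^rV_{i_j}}, & \text{if } w\in\bigcup_{j=1}^rV_{i_j},\\ 0, & \text{if } w\notin\bigcup_{j=1}^rV_{i_j}.\end{cases}$$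
   Context: A coalition is a subset of $W$; $\mathcal{P}(W)$ is the power set of $W$ and $\#A$ denotes cardinality. A minimal winning coalition is a $V\in\mathfrak{G}$ such that $V\setminus\{i\}\notin\mathfrak{G}$ for every $i\in V$. *)

theory Defs
  imports Complex_Main
begin

definition simple_game :: "'a set \<Rightarrow> 'a set set \<Rightarrow> bool" where
  "simple_game W G \<longleftrightarrow>
     finite W \<and> W \<noteq> {} \<and> G \<subseteq> Pow W \<and> W \<in> G \<and> {} \<notin> G \<and>
     (\<forall>A B. A \<in> G \<longrightarrow> A \<subseteq> B \<longrightarrow> B \<subseteq> W \<longrightarrow> B \<in> G)"

definition minimal_winning :: "'a set set \<Rightarrow> 'a set set" where
  "minimal_winning G = {V \<in> G. \<forall>i\<in>V. V - {i} \<notin> G}"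

text \<open>
  The truncated subtractions on natural numbers below are harmless: for a game on \<open>W\<close>, every
  coalition \<open>S\<close> in the sum satisfies \<open>S \<subseteq> W\<close> and contains \<open>w\<close>, so
  \<open>1 \<le> card S \<le> card W\<close>.
\<close>

definition SSI :: "'a set \<Rightarrow> 'a set set \<Rightarrow> 'a \<Rightarrow> real" where
  "SSI W G w =
     (\<Sum>S\<in>{S \<in> G. w \<in> S \<and> S - {w} \<notin> G}.
        fact (card W - card S) * fact (card S - 1) / fact (card W))"

text \<open>
  Index tuples \<open>1 \<le> i\<^sub>1 < \<dots> < i\<^sub>r \<le> m\<close> are represented as strictly increasing lists.
\<close>

definition increasing_tuples :: "nat \<Rightarrow> nat \<Rightarrow> nat list set" where
  "increasing_tuples r m = {is. length is = r \<and> sorted_wrt (<) is \<and> set is \<subseteq> {1..m}}"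

definition s_coeff :: "(nat \<Rightarrow> 'a set) \<Rightarrow> nat list \<Rightarrow> 'a \<Rightarrow> real" where
  "s_coeff V is w =
     (if w \<in> (\<Union>i\<in>set is. V i) then 1 / real (card (\<Union>i\<in>set is. V i)) else 0)"

end

theory Submission
  imports Defs
begin

text \<open>
  Written as a weighted sum of the marginal contributions of \<open>w\<close>, the index makes sense for an
  arbitrary family of coalitions and is additive in that family. A simple game is the union of the
  families of supersets of its minimal winning coalitions, and the intersection of the families of
  supersets of \<open>V\<^sub>i\<close> is the family of supersets of the union of the \<open>V\<^sub>i\<close>. So
  inclusion-exclusion reduces the claim to the unanimity game of a single coalition \<open>U\<close>, in
  which each member of \<open>U\<close> has index \<open>1 / card U\<close>.
\<close>

definition marginal_sum :: "'a set \<Rightarrow> 'a \<Rightarrow> 'a set set \<Rightarrow> real" where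
  "marginal_sum W w C =
     (\<Sum>S | S \<subseteq> W \<and> w \<in> S. fact (card W - card S) * fact (card S - 1) / fact (card W) *
        (of_bool (S \<in> C) - of_bool (S - {w} \<in> C)))"

definition supersets_in :: "'a set \<Rightarrow> 'a set \<Rightarrow> 'a set set" where
  "supersets_in W U = {S. U \<subseteq> S \<and> S \<subseteq> W}"

text \<open>The range of summation and the weights do not depend on the family, and membership
  indicators add over disjoint families. This is the additivity that inclusion-exclusion asks
  for.\<close>

lemma marginal_sum_Un:
  assumes "disjnt C D"
  shows "marginal_sum W w (C \<union> D) = marginal_sum W w C + marginal_sum W w D"
proof -
  have "of_bool (S \<in> C \<union> D) = (of_bool (S \<in> C) + of_bool (S \<in> D) :: real)" for S
    using assms by (auto simp: disjnt_iff)
  then show ?thesis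
    unfolding marginal_sum_def sum.distrib[symmetric]
    by (intro sum.cong refl) (simp only:, simp add: algebra_simps add_divide_distrib diff_divide_distrib)
qed

text \<open>Monotonicity rules out \<open>S - {w} \<in> G\<close> with \<open>S \<notin> G\<close>,
  so the marginal contribution is never -1: it is the indicator that \<open>w\<close> is pivotal in
  \<open>S\<close>.\<close>

lemma SSI_eq_marginal_sum:
  assumes "simple_game W G" "w \<in> W"
  shows "SSI W G w = marginal_sum W w G"
proof -
  have fin: "finite W" and sub: "G \<subseteq> Pow W"
    and mono: "\<And>A B. A \<in> G \<Longrightarrow> A \<subseteq> B \<Longrightarrow> B \<subseteq> W \<Longrightarrow> B \<in> G"
    using assms by (auto simp: simple_game_def)
  have "of_bool (S \<in> G) - of_bool (S - {w} \<in> G) = (of_bool (S \<in> G \<and> S - {w} \<notin> G) :: real)"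
    if "S \<subseteq> W" for S
    using mono[of "S - {w}" S] that by auto
  then have "marginal_sum W w G = (\<Sum>S | S \<subseteq> W \<and> w \<in> S.
      fact (card W - card S) * fact (card S - 1) / fact (card W) *
      of_bool (S \<in> G \<and> S - {w} \<notin> G))"
    unfolding marginal_sum_def by (intro sum.cong) auto
  also have "\<dots> = SSI W G w"
    unfolding SSI_def using fin sub by (intro sum.mono_neutral_cong_right) auto
  finally show ?thesis by simp
qed

text \<open>
  The recurrence pairs \<open>T\<close> with \<open>insert x T\<close>: the two weights share a factor, and the remaining
  factors \<open>card R + 1 - card T\<close> and \<open>u + card T\<close> have a sum independent of \<open>T\<close>.
\<close>

lemma sum_Pow_fact:
  assumes "finite R" "u > 0"
  shows "(\<Sum>T\<in>Pow R. fact (card R - card T) * fact (u + card T - 1) :: real) =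
         fact (u + card R) / real u"
  using assms(1)
proof (induction R)
  case empty
  then show ?case using assms(2) by (simp add: fact_reduce[of u])
next
  case (insert x R)
  let ?r = "card R"
  have inj: "inj_on (insert x) (Pow R)"
    using insert.hyps by (auto simp: inj_on_def)
  have "fact (Suc ?r - card T) * fact (u + card T - 1) +
        fact (Suc ?r - card (insert x T)) * fact (u + card (insert x T) - 1) =
        real (Suc (u + ?r)) * (fact (?r - card T) * fact (u + card T - 1))"
    if "T \<in> Pow R" for T
  proof -
    have T: "finite T" "x \<notin> T" "card T \<le> ?r"
      using that insert.hyps by (auto intro: finite_subset card_mono)
    have 1: "fact (Suc ?r - card T) = real (Suc ?r - card T) * fact (?r - card T)"
      using T by (simp add: Suc_diff_le)
    have 2: "fact (u + card T) = real (u + card T) * fact (u + card T - 1)"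
      using assms(2) by (intro fact_reduce) simp
    have "fact (Suc ?r - card T) * fact (u + card T - 1) + fact (?r - card T) * fact (u + card T) =
        (real (Suc ?r - card T) + real (u + card T)) * (fact (?r - card T) * fact (u + card T - 1))"
      unfolding 1 2 by (simp only: algebra_simps)
    also have "real (Suc ?r - card T) + real (u + card T) = real (Suc (u + ?r))"
      using T by simp
    finally show ?thesis
      using T by simp
  qed
  moreover have "Pow R \<inter> insert x ` Pow R = {}"
    using insert.hyps by auto
  ultimately have "(\<Sum>T\<in>Pow (insert x R). fact (card (insert x R) - card T) * fact (u + card T - 1)) =
      (\<Sum>T\<in>Pow R. real (Suc (u + ?r)) * (fact (?r - card T) * fact (u + card T - 1)))"
    using insert.hyps
    by (simp add: Pow_insert sum.union_disjoint sum.reindex[OF inj] sum.distrib[symmetric]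
        del: of_nat_Suc)
  also have "\<dots> = fact (u + card (insert x R)) / real u"
    using insert by (simp add: sum_distrib_left[symmetric])
  finally show ?case .
qed

text \<open>If \<open>w\<close> lies outside \<open>U\<close>, deleting it never affects containment
  of \<open>U\<close>, so every term vanishes. If \<open>w\<close> lies in \<open>U\<close>, it is
  pivotal in every superset of \<open>U\<close>, and writing these as \<open>U \<union> T\<close>
  with \<open>T \<subseteq> W - U\<close> leaves a sum over a power set.\<close>

lemma marginal_sum_supersets_in:
  assumes "finite W" "U \<subseteq> W"
  shows "marginal_sum W w (supersets_in W U) = (if w \<in> U then 1 / real (card U) else 0)"
proof (cases "w \<in> U")
  case False
  then have "S \<in> supersets_in W U \<longleftrightarrow> S - {w} \<in> supersets_in W U" if "S \<subseteq> W" for S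
    using that by (auto simp: supersets_in_def)
  then show ?thesis
    using False by (auto simp: marginal_sum_def intro!: sum.neutral)
next
  case True
  let ?c = "\<lambda>S. fact (card W - card S) * fact (card S - 1) / fact (card W) :: real"
  have U: "finite U" "card U > 0"
    using assms True by (auto simp: card_gt_0_iff intro: finite_subset)
  have W: "card W = card U + card (W - U)"
    using assms U by (simp add: card_Diff_subset card_mono)
  have "marginal_sum W w (supersets_in W U) = (\<Sum>S\<in>supersets_in W U. ?c S)"
    unfolding marginal_sum_def using True assms
    by (intro sum.mono_neutral_cong_right) (auto simp: supersets_in_def)
  also have "\<dots> = (\<Sum>T\<in>Pow (W - U). ?c (U \<union> T))"
    using assms
    by (intro sum.reindex_bij_witness[of _ "\<lambda>T. U \<union> T" "\<lambda>S. S - U"])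
       (auto simp: supersets_in_def Un_absorb1)
  also have "\<dots> = (\<Sum>T\<in>Pow (W - U).
      fact (card (W - U) - card T) * fact (card U + card T - 1) / fact (card W))"
  proof (intro sum.cong refl)
    fix T assume "T \<in> Pow (W - U)"
    then have "card (U \<union> T) = card U + card T"
      using U assms by (intro card_Un_disjoint) (auto intro: finite_subset)
    then show "?c (U \<union> T) =
        fact (card (W - U) - card T) * fact (card U + card T - 1) / fact (card W)"
      by (simp add: W)
  qed
  \<comment> \<open>The sum is \<open>sum_Pow_fact\<close> with \<open>R = W - U\<close> and
    \<open>u = card U\<close>, where \<open>u + card R = card W\<close>.\<close>
  also have "\<dots> = fact (card W) / real (card U) / fact (card W)"
    using sum_Pow_fact[of "W - U" "card U"] assms U
    by (simp add: sum_divide_distrib[symmetric] W)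
  finally show ?thesis
    using True by simp
qed

text \<open>As long as some member can be deleted without leaving \<open>G\<close>, delete it; by
  finiteness the descent stops at a minimal coalition.\<close>

lemma ex_minimal_winning_subset:
  assumes "finite S" "S \<in> G"
  shows "\<exists>V\<in>minimal_winning G. V \<subseteq> S"
  using assms
proof (induction S rule: finite_psubset_induct)
  case (psubset S)
  show ?case
  proof (cases "S \<in> minimal_winning G")
    case False
    then obtain i where "i \<in> S" "S - {i} \<in> G"
      using psubset.prems by (auto simp: minimal_winning_def)
    then show ?thesis
      using psubset.IH[of "S - {i}"] by blast
  qed blast
qed

text \<open>One inclusion is the descent to a minimal winning coalition, the other is
  monotonicity.\<close>

lemma simple_game_eq_UN_supersets_in:
  assumes "simple_game W G"
  shows "G = (\<Union>V\<in>minimal_winning G. supersets_in W V)"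
proof -
  have "finite W" and GW: "G \<subseteq> Pow W"
    and mono: "\<And>A B. A \<in> G \<Longrightarrow> A \<subseteq> B \<Longrightarrow> B \<subseteq> W \<Longrightarrow> B \<in> G"
    using assms by (auto simp: simple_game_def)
  have "\<exists>V\<in>minimal_winning G. S \<in> supersets_in W V" if "S \<in> G" for S
  proof -
    have "S \<subseteq> W"
      using that GW by blast
    with ex_minimal_winning_subset[OF finite_subset[OF _ \<open>finite W\<close>] that]
    show ?thesis
      by (auto simp: supersets_in_def)
  qed
  moreover have "S \<in> G" if "V \<in> minimal_winning G" "S \<in> supersets_in W V" for V S
    using that mono[of V S] by (simp add: minimal_winning_def supersets_in_def)
  ultimately show ?thesis
    by blast
qed

text \<open>For empty \<open>I\<close> the left side would be \<open>UNIV\<close> and the right side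
  \<open>Pow W\<close>.\<close>

lemma INT_supersets_in:
  assumes "I \<noteq> {}"
  shows "(\<Inter>i\<in>I. supersets_in W (V i)) = supersets_in W (\<Union>i\<in>I. V i)"
  using assms by (auto simp: supersets_in_def)

text \<open>A strictly increasing list is recovered from its set by sorting. This turns sums over
  tuples into sums over index sets, the form in which inclusion-exclusion is stated.\<close>

lemma bij_betw_set_increasing_tuples:
  "bij_betw set (increasing_tuples r m) {I. I \<subseteq> {1..m} \<and> card I = r}"
proof (rule bij_betw_byWitness[where f' = sorted_list_of_set])
  show "\<forall>is\<in>increasing_tuples r m. sorted_list_of_set (set is) = is"
    by (auto simp: increasing_tuples_def strict_sorted_iff sorted_list_of_set.idem_if_sorted_distinct)
  have fin: "finite I" if "I \<subseteq> {1..m}" for I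
    using that finite_subset by blast
  show "\<forall>I\<in>{I. I \<subseteq> {1..m} \<and> card I = r}. set (sorted_list_of_set I) = I"
    using fin by simp
  show "set ` increasing_tuples r m \<subseteq> {I. I \<subseteq> {1..m} \<and> card I = r}"
    by (auto simp: increasing_tuples_def strict_sorted_iff distinct_card)
  show "sorted_list_of_set ` {I. I \<subseteq> {1..m} \<and> card I = r} \<subseteq> increasing_tuples r m"
    using fin by (simp add: increasing_tuples_def image_subset_iff)
qed

theorem theorem2:
  fixes n m :: nat and W :: "nat set" and G :: "nat set set"
    and V :: "nat \<Rightarrow> nat set" and w :: nat
  assumes "W = {1..n}"
    and "simple_game W G"
    and "m = card (minimal_winning G)"
    and "bij_betw V {1..m} (minimal_winning G)"
    and "w \<in> W"
  shows "SSI W G w =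
    (\<Sum>r = 1..m. (-1) ^ (r - 1) * (\<Sum>is\<in>increasing_tuples r m. s_coeff V is w))"
proof -
  \<comment> \<open>The counterpart of \<open>s_coeff\<close> for index sets in place of
    lists.\<close>
  define s where
    "s I = (if w \<in> (\<Union>i\<in>I. V i) then 1 / real (card (\<Union>i\<in>I. V i)) else 0)" for I
  let ?N = "{I. I \<subseteq> {1..m} \<and> I \<noteq> {}}"
  have fin: "finite W" and GW: "G \<subseteq> Pow W"
    using assms(2) by (simp_all add: simple_game_def)
  have VW: "V i \<subseteq> W" if "i \<in> {1..m}" for i
    using GW bij_betwE[OF assms(4)] that unfolding minimal_winning_def by blast
  have "(\<Union>i\<in>{1..m}. supersets_in W (V i)) = (\<Union>U\<in>V ` {1..m}. supersets_in W U)"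
    by blast
  also have "V ` {1..m} = minimal_winning G"
    using assms(4) by (rule bij_betw_imp_surj_on)
  finally have "SSI W G w = marginal_sum W w (\<Union>i\<in>{1..m}. supersets_in W (V i))"
    using SSI_eq_marginal_sum[OF assms(2,5)] simple_game_eq_UN_supersets_in[OF assms(2)] by simp
  also have "\<dots> = (\<Sum>I\<in>?N. (-1) ^ (card I + 1) *
      marginal_sum W w (\<Inter>i\<in>I. supersets_in W (V i)))"
    by (rule Incl_Excl_UN) (simp_all add: marginal_sum_Un)
  also have "\<dots> = (\<Sum>I\<in>?N. (-1) ^ (card I + 1) * s I)"
  proof (intro sum.cong refl)
    fix I assume I: "I \<in> ?N"
    then have "(\<Union>i\<in>I. V i) \<subseteq> W"
      using VW by blast
    then show "(-1) ^ (card I + 1) * marginal_sum W w (\<Inter>i\<in>I. supersets_in W (V i)) =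
        (-1) ^ (card I + 1) * s I"
      using I by (simp add: INT_supersets_in marginal_sum_supersets_in[OF fin] s_def)
  qed
  \<comment> \<open>Group the nonempty index sets by size, on which alone the sign depends.\<close>
  also have "\<dots> = (\<Sum>r = 1..m. \<Sum>I\<in>{I \<in> ?N. card I = r}. (-1) ^ (card I + 1) * s I)"
  proof (rule sum.group[symmetric])
    show "card ` ?N \<subseteq> {1..m}"
    proof (rule image_subsetI)
      fix I assume "I \<in> ?N"
      then have I: "I \<subseteq> {1..m}" "I \<noteq> {}"
        by auto
      then have "finite I"
        by (auto intro: finite_subset)
      then show "card I \<in> {1..m}"
        using I card_mono[OF _ I(1)] by (simp add: Suc_le_eq card_gt_0_iff)
    qed
  qed auto
  also have "\<dots> = (\<Sum>r = 1..m. (-1) ^ (r - 1) * (\<Sum>is\<in>increasing_tuples r m. s_coeff V is w))"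
  proof (intro sum.cong refl)
    fix r assume r: "r \<in> {1..m}"
    \<comment> \<open>Since \<open>r \<ge> 1\<close>, the subtraction is not truncated and the
      exponents differ by 2.\<close>
    then have sign: "(-1) ^ (r + 1) = ((-1) ^ (r - 1) :: real)"
      by (cases r) auto
    have "{I \<in> ?N. card I = r} = {I. I \<subseteq> {1..m} \<and> card I = r}"
      using r by auto
    then have "(\<Sum>I\<in>{I \<in> ?N. card I = r}. (-1) ^ (card I + 1) * s I) =
        (-1) ^ (r - 1) * (\<Sum>I | I \<subseteq> {1..m} \<and> card I = r. s I)"
      unfolding sum_distrib_left sign[symmetric] by (intro sum.cong) auto
    also have "(\<Sum>I | I \<subseteq> {1..m} \<and> card I = r. s I) =
        (\<Sum>is\<in>increasing_tuples r m. s_coeff V is w)"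
      unfolding sum.reindex_bij_betw[OF bij_betw_set_increasing_tuples, symmetric]
      by (simp add: s_def s_coeff_def)
    finally show "(\<Sum>I\<in>{I \<in> ?N. card I = r}. (-1) ^ (card I + 1) * s I) =
        (-1) ^ (r - 1) * (\<Sum>is\<in>increasing_tuples r m. s_coeff V is w)" .
  qed
  finally show ?thesis .
qed

end
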